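(* Let $I\subseteq\mathbb{R}$ be an interval and let $E\colon I\times I\to\mathbb{R}$ be a normalizable semideviation with normalization $E^*$. Then the following statements are equivalent: (i) at least one of the means $\underline{\underline{\mathcal{D}}}_E$, $\underline{\mathcal{D}}_E$, $\overline{\mathcal{D}}_E$, $\overline{\overline{\mathcal{D}}}_E$ is Jensen concave; (ii) for all $n\in\mathbb{N}$, $x,y\in I^n$ and $\lambda\in W_n(\mathbb{R})$, $$\overline{\overline{\mathcal{D}}}_E\Big(\frac{x+y}2,\lambda\Big)\ge\frac{\underline{\underline{\mathcal{D}}}_E(x,\lambda)+\underline{\underline{\mathcal{D}}}_E(y,\lambda)}2;$$ (iii) $E^*$ is Jensen concave on $I\times I$; (iv) $E^*$ is a quasideviation (hence so is $E$) and $\mathcal{D}_E$ is Jensen concave; (v) all of the means $\underline{\underline{\mathcal{D}}}_E$, $\underline{\mathcal{D}}_E$, $\overline{\mathcal{D}}_E$, $\overline{\overline{\mathcal{D}}}_E$ are Jensen concave.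
   Context: For $n\in\mathbb{N}$, $W_n(\mathbb{R})=\{(\lambda_1,\dots,\lambda_n)\in\mathbb{R}^n\mid\lambda_i\ge0\ \forall i,\ \lambda_1+\dots+\lambda_n>0\}$. A function $\mathcal{M}\colon\bigcup_nI^n\times W_n(\mathbb{R})\to I$ is Jensen concave if $\mathcal{M}(\frac{x+y}2,\lambda)\ge\frac12(\mathcal{M}(x,\lambda)+\mathcal{M}(y,\lambda))$ for all $n\in\mathbb{N}$, $x,y\in I^n$, $\lambda\in W_n(\mathbb{R})$. A function $G\colon I\times I\to\mathbb{R}$ is Jensen concave if $G(\frac{x+y}2,\frac{u+v}2)\ge\frac12(G(x,u)+G(y,v))$ for all $x,y,u,v\in I$. A function $E\colon I\times I\to\mathbb{R}$ is a semideviation if for all distinct $x,y\in I$ the sign of $E(x,y)$ equals the sign of $x-y$. For $(x,\lambda)\in I^n\times W_n(\mathbb{R})$ let $e(y)=\lambda_1E(x_1,y)+\cdots+\lambda_nE(x_n,y)$, $y\in I$, and define $\underline{\underline{\mathcal{D}}}_E(x,\lambda)=\inf\{y\in I\mid e(y)\le0\}$, $\ \overline{\overline{\mathcal{D}}}_E(x,\lambda)=\sup\{y\in I\mid e(y)\ge0\}$, $\underline{\mathcal{D}}_E(x,\lambda)=\inf\{y\in I\mid e(y)<0\}$, $\ \overline{\mathcal{D}}_E(x,\lambda)=\sup\{y\in I\mid e(y)>0\}$. Equivalently, $\underline{\underline{\mathcal{D}}}_E(x,\lambda)=\sup\{y\in I: e|_{(-\infty,y)\cap I}>0\}$, $\overline{\overline{\mathcal{D}}}_E(x,\lambda)=\inf\{y\in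 I: e|_{(y,\infty)\cap I}<0\}$, $\underline{\mathcal{D}}_E(x,\lambda)=\sup\{y\in I: e|_{(-\infty,y)\cap I}\ge0\}$, $\overline{\mathcal{D}}_E(x,\lambda)=\inf\{y\in I: e|_{(y,\infty)\cap I}\le0\}$ (this second description is the one used if a set in the first description is empty, which can only happen when $I$ contains an endpoint). A semideviation $E$ is a quasideviation if (a) for all $x\in I$ the map $y\mapsto E(x,y)$ is continuous, and (b) for all $x<y$ in $I$ the map $(x,y)\ni t\mapsto\frac{E(y,t)}{E(x,t)}$ is strictly increasing. If $E$ is a quasideviation, it is known that $\underline{\underline{\mathcal{D}}}_E=\overline{\overline{\mathcal{D}}}_E$ (so all four means coincide), and the common mean is denoted $\mathcal{D}_E$; $\mathcal{D}_E(x,\lambda)$ is the unique solution $y$ of $e(y)=0$. A semideviation $E\colon I\times I\to\mathbb{R}$ is normalizable if (a) for all $x\in I$ the function $y\mapsto E(x,y)$ is continuous on $I$; (b) for all $x\in I$ the function $y\mapsto E(x,y)$ is differentiable at $y=x$ (with derivative $\partial_2E(x,x)$); (c) $x\mapsto\partial_2E(x,x)$ is strictly negative and continuous on $I$. For a normalizable semideviation, $E(x,x)=0$ for all $x\in I$ (this is automatic when $x$ is an interior point of $I$, and is taken as part of the definition at endpoints belonging to $I$). Its normalization is $E^*(x,y)=\dfrac{E(x,y)}{-\partial_2E(y,y)}$, $x,y\in I$. *)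

theory Defs
  imports "HOL-Analysis.Analysis"
begin

text \<open>An n-tuple is represented by a function on \<open>nat\<close> of which only the values at
  \<open>0, \<dots>, n - 1\<close> are used. The length \<open>n\<close> is an explicit argument of every mean.
  A function of two variables on \<open>I \<times> I\<close> is a curried total function whose
  values off \<open>I \<times> I\<close> are never used.\<close>

type_synonym wmean = "nat \<Rightarrow> (nat \<Rightarrow> real) \<Rightarrow> (nat \<Rightarrow> real) \<Rightarrow> real"

definition tuples :: "real set \<Rightarrow> nat \<Rightarrow> (nat \<Rightarrow> real) set" where
  "tuples I n = {x. \<forall>i<n. x i \<in> I}"

text \<open>This set is empty for \<open>n = 0\<close>, so quantifying over all \<open>n\<close> amounts to
  quantifying over \<open>n \<ge> 1\<close>.\<close>

definition weights :: "nat \<Rightarrow> (nat \<Rightarrow> real) set" where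
  "weights n = {l. (\<forall>i<n. 0 \<le> l i) \<and> (\<Sum>i<n. l i) > 0}"

definition jensen_concave_mean :: "real set \<Rightarrow> wmean \<Rightarrow> bool" where
  "jensen_concave_mean I M \<longleftrightarrow>
     (\<forall>n. \<forall>x\<in>tuples I n. \<forall>y\<in>tuples I n. \<forall>l\<in>weights n.
        M n (\<lambda>i. (x i + y i) / 2) l \<ge> (M n x l + M n y l) / 2)"

definition jensen_concave2 :: "real set \<Rightarrow> (real \<Rightarrow> real \<Rightarrow> real) \<Rightarrow> bool" where
  "jensen_concave2 I G \<longleftrightarrow>
     (\<forall>x\<in>I. \<forall>y\<in>I. \<forall>u\<in>I. \<forall>v\<in>I.
        G ((x + y) / 2) ((u + v) / 2) \<ge> (G x u + G y v) / 2)"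

definition semideviation :: "real set \<Rightarrow> (real \<Rightarrow> real \<Rightarrow> real) \<Rightarrow> bool" where
  "semideviation I E \<longleftrightarrow>
     (\<forall>x\<in>I. \<forall>y\<in>I. x \<noteq> y \<longrightarrow> sgn (E x y) = sgn (x - y))"

definition esum ::
    "(real \<Rightarrow> real \<Rightarrow> real) \<Rightarrow> nat \<Rightarrow> (nat \<Rightarrow> real) \<Rightarrow> (nat \<Rightarrow> real) \<Rightarrow> real \<Rightarrow> real" where
  "esum E n x l y = (\<Sum>i<n. l i * E (x i) y)"

text \<open>The four semideviation means, from the smallest (doubly underlined) to the largest
  (doubly overlined). The first branch is the equivalent description by the sign of the sum
  to the left (respectively right) of a point; it is needed when the set in the
  second branch is empty, where \<open>Inf\<close> and \<open>Sup\<close> on the reals carry no information.\<close>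

definition D_lower_lower :: "real set \<Rightarrow> (real \<Rightarrow> real \<Rightarrow> real) \<Rightarrow> wmean" where
  "D_lower_lower I E n x l =
     (if {y\<in>I. esum E n x l y \<le> 0} = {}
      then Sup {y\<in>I. \<forall>z\<in>I. z < y \<longrightarrow> esum E n x l z > 0}
      else Inf {y\<in>I. esum E n x l y \<le> 0})"

definition D_lower :: "real set \<Rightarrow> (real \<Rightarrow> real \<Rightarrow> real) \<Rightarrow> wmean" where
  "D_lower I E n x l =
     (if {y\<in>I. esum E n x l y < 0} = {}
      then Sup {y\<in>I. \<forall>z\<in>I. z < y \<longrightarrow> esum E n x l z \<ge> 0}
      else Inf {y\<in>I. esum E n x l y < 0})"

definition D_upper :: "real set \<Rightarrow> (real \<Rightarrow> real \<Rightarrow> real) \<Rightarrow> wmean" where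
  "D_upper I E n x l =
     (if {y\<in>I. esum E n x l y > 0} = {}
      then Inf {y\<in>I. \<forall>z\<in>I. z > y \<longrightarrow> esum E n x l z \<le> 0}
      else Sup {y\<in>I. esum E n x l y > 0})"

definition D_upper_upper :: "real set \<Rightarrow> (real \<Rightarrow> real \<Rightarrow> real) \<Rightarrow> wmean" where
  "D_upper_upper I E n x l =
     (if {y\<in>I. esum E n x l y \<ge> 0} = {}
      then Inf {y\<in>I. \<forall>z\<in>I. z > y \<longrightarrow> esum E n x l z < 0}
      else Sup {y\<in>I. esum E n x l y \<ge> 0})"

definition quasideviation :: "real set \<Rightarrow> (real \<Rightarrow> real \<Rightarrow> real) \<Rightarrow> bool" where
  "quasideviation I E \<longleftrightarrow>
     semideviation I E \<and>
     (\<forall>x\<in>I. continuous_on I (\<lambda>y. E x y)) \<and>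
     (\<forall>x\<in>I. \<forall>y\<in>I. x < y \<longrightarrow> strict_mono_on {x<..<y} (\<lambda>t. E y t / E x t))"

text \<open>Meaningful when \<open>E\<close> is a quasideviation; the zero of the sum is then unique and is
  the common value of the four means above.\<close>

definition D_quasi :: "real set \<Rightarrow> (real \<Rightarrow> real \<Rightarrow> real) \<Rightarrow> wmean" where
  "D_quasi I E n x l = (THE y. y \<in> I \<and> esum E n x l y = 0)"

text \<open>The derivative is taken within \<open>I\<close>, hence one-sided at an endpoint belonging to \<open>I\<close>.\<close>

definition diag_deriv2 :: "real set \<Rightarrow> (real \<Rightarrow> real \<Rightarrow> real) \<Rightarrow> real \<Rightarrow> real" where
  "diag_deriv2 I E x = vector_derivative (\<lambda>y. E x y) (at x within I)"

definition normalizable :: "real set \<Rightarrow> (real \<Rightarrow> real \<Rightarrow> real) \<Rightarrow> bool" where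
  "normalizable I E \<longleftrightarrow>
     semideviation I E \<and>
     (\<forall>x\<in>I. E x x = 0) \<and>
     (\<forall>x\<in>I. continuous_on I (\<lambda>y. E x y)) \<and>
     (\<forall>x\<in>I. (\<lambda>y. E x y) differentiable (at x within I)) \<and>
     (\<forall>x\<in>I. diag_deriv2 I E x < 0) \<and>
     continuous_on I (diag_deriv2 I E)"

definition normalization ::
    "real set \<Rightarrow> (real \<Rightarrow> real \<Rightarrow> real) \<Rightarrow> real \<Rightarrow> real \<Rightarrow> real" where
  "normalization I E x y = E x y / (- diag_deriv2 I E y)"

end

theory Submission
  imports Defs
begin

text \<open>Every semideviation mean of a normalizable semideviation \<open>E\<close> is a zero of the continuous
  function \<open>e\<close>, the double underlined and overlined ones being the smallest and the largest zero.
  A zero \<open>z\<^sub>t\<close> of \<open>t E(x, \<cdot>) + E(u, \<cdot>)\<close> satisfies \<open>(z\<^sub>t - u) / t \<rightarrow> E\<^sup>*(x, u)\<close> as \<open>t \<rightarrow> 0\<close>, so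
  concavity of the means for the weights \<open>(t, 1)\<close> yields, in the limit, concavity of \<open>E\<^sup>*\<close>.
  Conversely, if \<open>E\<^sup>*\<close> is Jensen concave, then the functions \<open>\<alpha> E\<^sup>*(x, \<cdot>) + \<beta> E\<^sup>*(y, \<cdot>)\<close> with
  \<open>x < y\<close> and \<open>\<alpha>, \<beta> > 0\<close> are midpoint concave, continuous and positive at \<open>x\<close>, so they are negative
  to the right of any zero beyond \<open>x\<close>. This is the monotonicity required of a quasideviation; it makes the
  zero of \<open>e\<close> unique, and Jensen concavity of \<open>E\<^sup>*\<close> evaluated at zeros gives that of the mean.\<close>

section \<open>Preliminaries: midpoints, and zeros of continuous functions at infima and
  suprema\<close>

lemma tuples_mid:
  assumes "is_interval I" "x \<in> tuples I n" "y \<in> tuples I n"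
  shows "(\<lambda>i. (x i + y i) / 2) \<in> tuples I n"
proof -
  have "(a + b) / 2 \<in> I" if "a \<in> I" "b \<in> I" for a b
    using that assms(1) convexD[of I a b "1/2" "1/2"]
    by (auto simp: is_interval_convex_1 field_simps)
  then show ?thesis using assms by (auto simp: tuples_def)
qed

lemma limit_nonpos:
  fixes h :: "real \<Rightarrow> real"
  assumes "continuous_on I h" "S \<subseteq> I" "c \<in> I" "c \<in> closure S" "\<And>y. y \<in> S \<Longrightarrow> h y \<le> 0"
  shows "h c \<le> 0"
proof -
  obtain f where f: "\<And>n. f n \<in> S" "f \<longlonglongrightarrow> c"
    using assms(4) by (auto simp: closure_sequential)
  have "(\<lambda>n. h (f n)) \<longlonglongrightarrow> h c"
    using f(1) assms(2)
    by (intro continuous_on_tendsto_compose[OF assms(1) f(2) assms(3)] always_eventually) auto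
  then show ?thesis
    using f(1) assms(5) by (intro LIMSEQ_le_const2) auto
qed

text \<open>Limits of points of \<open>S\<close> give \<open>h (Inf S) \<le> 0\<close>. The points
  strictly between \<open>a\<close> and \<open>Inf S\<close> lie outside \<open>S\<close>, so the
  opposite inequality is a limit from the left; if \<open>a = Inf S\<close>, it is the hypothesis on
  \<open>a\<close>. The set is kept abstract to cover both weak and strict sign sets.\<close>

lemma Inf_zero:
  fixes h :: "real \<Rightarrow> real"
  assumes I: "is_interval I" and h: "continuous_on I h"
    and S: "S \<subseteq> I" "S \<noteq> {}"
    and le: "\<And>y. y \<in> S \<Longrightarrow> h y \<le> 0"
    and ge: "\<And>y. y \<in> I \<Longrightarrow> y \<notin> S \<Longrightarrow> h y \<ge> 0"
    and a: "a \<in> I" "h a \<ge> 0" "\<And>y. y \<in> S \<Longrightarrow> a \<le> y"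
  shows "Inf S \<in> I" "h (Inf S) = 0"
proof -
  have bdd: "bdd_below S" using a by (meson bdd_below.I)
  obtain s where s: "s \<in> S" using S by auto
  have as: "a \<le> Inf S" "Inf S \<le> s" using S a bdd s by (auto intro: cInf_greatest cInf_lower)
  show c: "Inf S \<in> I" using as I a(1) s S(1) by (meson mem_is_interval_1_I subsetD)
  have "h (Inf S) \<le> 0"
    using limit_nonpos[OF h S(1) c closure_contains_Inf] S bdd le by auto
  moreover have "h (Inf S) \<ge> 0"
  proof (cases "a = Inf S")
    case False
    then have lt: "a < Inf S" using as by simp
    have mem: "y \<in> I" "h y \<ge> 0" if "y \<in> {a<..<Inf S}" for y
    proof -
      show "y \<in> I" using that I a(1) c by (meson greaterThanLessThan_iff less_imp_le mem_is_interval_1_I)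
      moreover have "y \<notin> S" using that bdd cInf_lower[of y S] by auto
      ultimately show "h y \<ge> 0" using ge by auto
    qed
    have "- h (Inf S) \<le> 0"
      by (rule limit_nonpos[where I = I and S = "{a<..<Inf S}"])
        (use mem h lt c in \<open>auto intro: continuous_on_minus\<close>)
    then show ?thesis by simp
  qed (use a in auto)
  ultimately show "h (Inf S) = 0" by simp
qed

text \<open>Reflecting the line at 0 and replacing \<open>h\<close> by
  \<open>\<lambda>y. - h (- y)\<close> reduces this to \<open>Inf_zero\<close>.\<close>

lemma Sup_zero:
  fixes h :: "real \<Rightarrow> real"
  assumes I: "is_interval I" and h: "continuous_on I h"
    and S: "S \<subseteq> I" "S \<noteq> {}"
    and ge: "\<And>y. y \<in> S \<Longrightarrow> h y \<ge> 0"
    and le: "\<And>y. y \<in> I \<Longrightarrow> y \<notin> S \<Longrightarrow> h y \<le> 0"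
    and b: "b \<in> I" "h b \<le> 0" "\<And>y. y \<in> S \<Longrightarrow> y \<le> b"
  shows "Sup S \<in> I" "h (Sup S) = 0"
proof -
  have "is_interval (uminus ` I)" using I by (simp add: is_interval_uminus)
  moreover have "continuous_on (uminus ` I) (\<lambda>y. - h (- y))"
    by (intro continuous_intros continuous_on_compose2[OF h]) auto
  ultimately have "Inf (uminus ` S) \<in> uminus ` I \<and> - h (- Inf (uminus ` S)) = 0"
    by (intro conjI Inf_zero[of "uminus ` I" "\<lambda>y. - h (- y)" "uminus ` S" "- b"])
      (use S ge le b in \<open>auto simp: image_iff\<close>)
  then show "Sup S \<in> I" "h (Sup S) = 0"
    by (auto simp: Inf_real_def image_image)
qed

section \<open>Signs of a semideviation and of its weighted sums\<close>

lemma semideviation_pos: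
  assumes "semideviation I E" "x \<in> I" "y \<in> I" "y < x"
  shows "E x y > 0"
  using assms by (auto simp: semideviation_def sgn_if split: if_splits)

lemma semideviation_neg:
  assumes "semideviation I E" "x \<in> I" "y \<in> I" "x < y"
  shows "E x y < 0"
  using assms by (force simp: semideviation_def sgn_if split: if_splits)

lemma semideviation_eq_0_iff:
  assumes "semideviation I E" "E x x = 0" "x \<in> I" "y \<in> I"
  shows "E x y = 0 \<longleftrightarrow> y = x"
  using assms semideviation_pos[of I E x y] semideviation_neg[of I E x y] by (cases x y rule: linorder_cases) auto

lemma weights_pos:
  assumes "l \<in> weights n"
  obtains i where "i < n" "l i > 0"
proof -
  have "(\<Sum>i<n. l i) > 0" using assms by (simp add: weights_def)
  then obtain i where "i < n" "l i > 0"
    by (metis lessThan_iff linorder_not_le sum_nonpos)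
  then show ?thesis using that by blast
qed

lemma esum_pos:
  assumes "l \<in> weights n" "\<And>i. i < n \<Longrightarrow> l i > 0 \<Longrightarrow> E (x i) y > 0"
  shows "esum E n x l y > 0"
proof -
  obtain i where i: "i < n" "l i > 0" using weights_pos[OF assms(1)] .
  show ?thesis unfolding esum_def
  proof (rule sum_pos2[of _ i])
    fix j assume "j \<in> {..<n}"
    then show "0 \<le> l j * E (x j) y"
      using assms by (cases "l j = 0") (force simp: weights_def)+
  qed (use i assms in auto)
qed

lemma esum_nonneg:
  assumes "l \<in> weights n" "\<And>i. i < n \<Longrightarrow> l i > 0 \<Longrightarrow> E (x i) y \<ge> 0"
  shows "esum E n x l y \<ge> 0"
  unfolding esum_def
proof (rule sum_nonneg)
  fix j assume "j \<in> {..<n}"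
  then show "0 \<le> l j * E (x j) y"
    using assms by (cases "l j = 0") (force simp: weights_def)+
qed

text \<open>\<open>esum_pos\<close> and \<open>esum_nonneg\<close> constrain only the signs of the
  kernel, so negating the kernel turns them into upper bounds.\<close>

lemma esum_uminus: "esum (\<lambda>x y. - E x y) n x l y = - esum E n x l y"
  by (simp add: esum_def sum_negf)

text \<open>The points are the least and the greatest \<open>x i\<close> of positive weight: beyond
  them all terms of positive weight have the same sign, and at them \<open>E x x = 0\<close> leaves
  weak inequalities. They are the bounds that \<open>Inf_zero\<close> and \<open>Sup_zero\<close>
  ask for.\<close>

lemma esum_bracket:
  assumes E: "semideviation I E" "\<And>x. x \<in> I \<Longrightarrow> E x x = 0"
    and x: "x \<in> tuples I n" and l: "l \<in> weights n"
  obtains a b where "a \<in> I" "b \<in> I" "esum E n x l a \<ge> 0" "esum E n x l b \<le> 0"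
    "\<And>y. y \<in> I \<Longrightarrow> y < a \<Longrightarrow> esum E n x l y > 0"
    "\<And>y. y \<in> I \<Longrightarrow> y > b \<Longrightarrow> esum E n x l y < 0"
proof -
  define J where "J = {i. i < n \<and> l i > 0}"
  have J: "finite J" "J \<noteq> {}" using weights_pos[OF l] by (auto simp: J_def)
  define a b where "a = Min (x ` J)" and "b = Max (x ` J)"
  have ab: "a \<in> x ` J" "b \<in> x ` J" using J by (auto simp: a_def b_def)
  have xI: "\<And>i. i \<in> J \<Longrightarrow> x i \<in> I" using x by (auto simp: J_def tuples_def)
  have I: "a \<in> I" "b \<in> I" using ab xI by auto
  have le: "a \<le> x i" "x i \<le> b" if "i \<in> J" for i using that J by (auto simp: a_def b_def)
  have pos: "E (x i) y > 0" if "i \<in> J" "y \<in> I" "y < a" for i y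
    using semideviation_pos[OF E(1) xI] le that by fastforce
  have neg: "E (x i) y < 0" if "i \<in> J" "y \<in> I" "y > b" for i y
    using semideviation_neg[OF E(1) xI] le that by fastforce
  have nonneg: "E (x i) a \<ge> 0" if "i \<in> J" for i
    using semideviation_pos[OF E(1) xI[OF that] I(1)] E(2) I le[OF that] by (cases "a = x i") auto
  have nonpos: "E (x i) b \<le> 0" if "i \<in> J" for i
    using semideviation_neg[OF E(1) xI[OF that] I(2)] E(2) I le[OF that] by (cases "b = x i") auto
  show ?thesis
  proof (rule that[OF I])
    show "esum E n x l a \<ge> 0" using nonneg l by (intro esum_nonneg) (auto simp: J_def)
    show "esum E n x l b \<le> 0"
      using esum_nonneg[OF l, of "\<lambda>x y. - E x y" x b] nonpos by (auto simp: J_def esum_uminus)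
    show "esum E n x l y > 0" if "y \<in> I" "y < a" for y
      using pos l that by (intro esum_pos) (auto simp: J_def)
    show "esum E n x l y < 0" if "y \<in> I" "y > b" for y
      using esum_pos[OF l, of "\<lambda>x y. - E x y" x y] neg that by (auto simp: J_def esum_uminus)
  qed
qed

lemma continuous_on_esum:
  assumes "\<And>x. x \<in> I \<Longrightarrow> continuous_on I (E x)" "x \<in> tuples I n"
  shows "continuous_on I (esum E n x l)"
  unfolding esum_def
  by (intro continuous_intros assms) (use assms in \<open>auto simp: tuples_def\<close>)

section \<open>The four means as zeros of the sum, and the two extreme ones\<close>

lemma normalizableD:
  assumes "normalizable I E"
  shows "semideviation I E" "\<And>x. x \<in> I \<Longrightarrow> E x x = 0" "\<And>x. x \<in> I \<Longrightarrow> continuous_on I (E x)"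
    "\<And>x. x \<in> I \<Longrightarrow> diag_deriv2 I E x < 0" "continuous_on I (diag_deriv2 I E)"
  using assms by (auto simp: normalizable_def)

lemma mean_zero:
  assumes I: "is_interval I" and E: "normalizable I E"
    and x: "x \<in> tuples I n" and l: "l \<in> weights n"
    and M: "M \<in> {D_lower_lower I E, D_lower I E, D_upper I E, D_upper_upper I E}"
  shows "M n x l \<in> I" "esum E n x l (M n x l) = 0"
proof -
  note E = normalizableD[OF E]
  let ?h = "esum E n x l"
  obtain a b where ab: "a \<in> I" "b \<in> I" "?h a \<ge> 0" "?h b \<le> 0"
    "\<And>y. y \<in> I \<Longrightarrow> y < a \<Longrightarrow> ?h y > 0" "\<And>y. y \<in> I \<Longrightarrow> y > b \<Longrightarrow> ?h y < 0"
    by (rule esum_bracket[OF E(1,2) x l]) (assumption, rule that)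
  note a = ab(1,3,5) and b = ab(2,4,6)
  have h: "continuous_on I ?h" using continuous_on_esum E x by blast
  have lower: "Inf S \<in> I \<and> ?h (Inf S) = 0"
    if S: "S = {y\<in>I. ?h y \<le> 0} \<or> S = {y\<in>I. ?h y < 0}" "S \<noteq> {}" for S
  proof -
    have S': "S \<subseteq> I" "\<And>y. y \<in> S \<Longrightarrow> ?h y \<le> 0" "\<And>y. y \<in> I \<Longrightarrow> y \<notin> S \<Longrightarrow> ?h y \<ge> 0"
      using S(1) by auto
    have "a \<le> y" if "y \<in> S" for y
      using S' \<open>y \<in> S\<close> a(3)[of y] by force
    from Inf_zero[OF I h S'(1) S(2) S'(2,3) a(1,2) this] show ?thesis by simp
  qed
  have upper: "Sup S \<in> I \<and> ?h (Sup S) = 0"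
    if S: "S = {y\<in>I. ?h y \<ge> 0} \<or> S = {y\<in>I. ?h y > 0}" "S \<noteq> {}" for S
  proof -
    have S': "S \<subseteq> I" "\<And>y. y \<in> S \<Longrightarrow> ?h y \<ge> 0" "\<And>y. y \<in> I \<Longrightarrow> y \<notin> S \<Longrightarrow> ?h y \<le> 0"
      using S(1) by auto
    have "y \<le> b" if "y \<in> S" for y
      using S' \<open>y \<in> S\<close> b(3)[of y] by force
    from Sup_zero[OF I h S'(1) S(2) S'(2,3) b(1,2) this] show ?thesis by simp
  qed
  \<comment> \<open>The sign set of \<open>D_lower_lower\<close> contains \<open>b\<close> and that
    of \<open>D_upper_upper\<close> contains \<open>a\<close>, so these two never reach the fallback
    branch.\<close>
  have "D_lower_lower I E n x l \<in> I \<and> ?h (D_lower_lower I E n x l) = 0"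
    using lower b by (auto simp: D_lower_lower_def)
  moreover have "D_upper_upper I E n x l \<in> I \<and> ?h (D_upper_upper I E n x l) = 0"
    using upper a by (auto simp: D_upper_upper_def)
  moreover have "D_lower I E n x l \<in> I \<and> ?h (D_lower I E n x l) = 0"
  proof (cases "{y\<in>I. ?h y < 0} = {}")
    \<comment> \<open>The sum is nowhere negative on \<open>I\<close>, yet negative to the right of
      \<open>b\<close>. Hence \<open>b\<close> is the largest element of \<open>I\<close>, the
      fallback supremum is \<open>b\<close>, and the sum vanishes there. The fallback of
      \<open>D_upper\<close> is the mirror image, with \<open>a\<close> the least element.\<close>
    case True
    then have nn: "\<And>y. y \<in> I \<Longrightarrow> ?h y \<ge> 0" by (auto simp: not_less)
    then have eq: "{y\<in>I. \<forall>z\<in>I. z < y \<longrightarrow> ?h z \<ge> 0} = I" by auto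
    have "y \<le> b" if "y \<in> I" for y
      using b(3)[OF that] nn[OF that] by linarith
    with b(1) have "Sup I = b" by (rule cSup_eq_maximum)
    then show ?thesis using True eq b(1,2) nn[OF b(1)] by (simp add: D_lower_def)
  qed (use lower in \<open>auto simp: D_lower_def\<close>)
  moreover have "D_upper I E n x l \<in> I \<and> ?h (D_upper I E n x l) = 0"
  proof (cases "{y\<in>I. ?h y > 0} = {}")
    case True
    then have nn: "\<And>y. y \<in> I \<Longrightarrow> ?h y \<le> 0" by (auto simp: not_less)
    then have eq: "{y\<in>I. \<forall>z\<in>I. z > y \<longrightarrow> ?h z \<le> 0} = I" by auto
    have "a \<le> y" if "y \<in> I" for y
      using a(3)[OF that] nn[OF that] by linarith
    with a(1) have "Inf I = a" by (rule cInf_eq_minimum)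
    then show ?thesis using True eq a(1,2) nn[OF a(1)] by (simp add: D_upper_def)
  qed (use upper in \<open>auto simp: D_upper_def\<close>)
  ultimately show "M n x l \<in> I" "?h (M n x l) = 0" using M by auto
qed

text \<open>The left end of the bracket bounds the sign set below, which makes its
  \<open>Inf\<close> a genuine infimum.\<close>

lemma D_lower_lower_le:
  assumes E: "normalizable I E" and x: "x \<in> tuples I n" and l: "l \<in> weights n"
    and y: "y \<in> I" "esum E n x l y \<le> 0"
  shows "D_lower_lower I E n x l \<le> y"
proof (rule esum_bracket[OF normalizableD(1,2)[OF E] x l])
  fix a assume "\<And>y. y \<in> I \<Longrightarrow> y < a \<Longrightarrow> esum E n x l y > 0"
  then have "bdd_below {y\<in>I. esum E n x l y \<le> 0}"
    by (intro bdd_belowI[of _ a]) force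
  then have "Inf {y\<in>I. esum E n x l y \<le> 0} \<le> y" using y by (intro cInf_lower) auto
  then show ?thesis using y by (auto simp: D_lower_lower_def)
qed

lemma D_upper_upper_ge:
  assumes E: "normalizable I E" and x: "x \<in> tuples I n" and l: "l \<in> weights n"
    and y: "y \<in> I" "esum E n x l y \<ge> 0"
  shows "y \<le> D_upper_upper I E n x l"
proof (rule esum_bracket[OF normalizableD(1,2)[OF E] x l])
  fix b assume "\<And>y. y \<in> I \<Longrightarrow> y > b \<Longrightarrow> esum E n x l y < 0"
  then have "bdd_above {y\<in>I. esum E n x l y \<ge> 0}"
    by (intro bdd_aboveI[of _ b]) force
  then have "y \<le> Sup {y\<in>I. esum E n x l y \<ge> 0}" using y by (intro cSup_upper) auto
  then show ?thesis using y by (auto simp: D_upper_upper_def)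
qed

section \<open>From the means to the normalization: asymptotics for small weights\<close>

text \<open>On the part of \<open>K\<close> outside a ball around \<open>u\<close> the absolute
  value of \<open>f\<close> has a positive minimum, and values tending to 0 eventually fall below
  it.\<close>

lemma tendsto_zero_of_compact:
  fixes f :: "real \<Rightarrow> real"
  assumes K: "compact K" "continuous_on K f" and u: "\<And>y. y \<in> K \<Longrightarrow> f y = 0 \<Longrightarrow> y = u"
    and z: "\<And>k::nat. z k \<in> K" "(\<lambda>k. f (z k)) \<longlonglongrightarrow> 0"
  shows "z \<longlonglongrightarrow> u"
proof (rule tendstoI)
  fix e :: real assume e: "e > 0"
  let ?L = "K - ball u e"
  have L: "compact ?L" "continuous_on ?L (\<lambda>y. \<bar>f y\<bar>)"
    using K by (auto intro!: compact_diff continuous_intros intro: continuous_on_subset)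
  show "\<forall>\<^sub>F k in sequentially. dist (z k) u < e"
  proof (cases "?L = {}")
    case True
    then have "dist (z k) u < e" for k using z(1)[of k] by (auto simp: dist_commute)
    then show ?thesis by (intro always_eventually) auto
  next
    case False
    obtain p where p: "p \<in> ?L" "\<And>y. y \<in> ?L \<Longrightarrow> \<bar>f p\<bar> \<le> \<bar>f y\<bar>"
      using continuous_attains_inf[OF L(1) False L(2)] by auto
    have "\<bar>f p\<bar> > 0" using p u e by force
    then have "\<forall>\<^sub>F k in sequentially. dist (f (z k)) 0 < \<bar>f p\<bar>" by (rule tendstoD[OF z(2)])
    then show ?thesis
      by eventually_elim (use p z(1) in \<open>force simp: dist_commute\<close>)
  qed
qed

text \<open>The equation for \<open>z k\<close> gives
  \<open>- E x (z k) = real (Suc k) * E u (z k)\<close>. So \<open>real (Suc k) * (z k - u)\<close>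
  is \<open>- E x (z k)\<close> divided by the difference quotient of \<open>E u\<close> at
  \<open>u\<close>, and both parts converge once \<open>z\<close> tends to \<open>u\<close>.\<close>

lemma zeros_asymptotics:
  assumes I: "is_interval I" and N: "normalizable I E" and x: "x \<in> I" and u: "u \<in> I"
    and z: "\<And>k::nat. z k \<in> I" "\<And>k. E x (z k) / real (Suc k) + E u (z k) = 0"
  shows "(\<lambda>k. real (Suc k) * (z k - u)) \<longlonglongrightarrow> normalization I E x u"
proof (cases "x = u")
  \<comment> \<open>Here the equation is a positive multiple of \<open>E u (z k) = 0\<close>, so
    \<open>z k = u\<close> and no difference quotient can be formed; both sides are 0.\<close>
  case True
  have "z k = u" for k
  proof -
    have "E u (z k) * (1 / real (Suc k) + 1) = 0" using z(2)[of k] True by (simp add: algebra_simps)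
    moreover have "1 / real (Suc k) + 1 > 0" by (simp add: add_pos_pos)
    ultimately have "E u (z k) = 0" by auto
    then show ?thesis using semideviation_eq_0_iff[of I E u] normalizableD[OF N] u z(1) by auto
  qed
  then show ?thesis using True normalizableD[OF N] u by (simp add: normalization_def)
next
  case False
  note E = normalizableD[OF N]
  let ?K = "closed_segment x u" and ?d = "diag_deriv2 I E u"
  have KI: "?K \<subseteq> I" using I x u by (simp add: closed_segment_subset is_interval_convex_1)
  have Ez: "E u (z k) = - (E x (z k) / real (Suc k))" for k using z(2)[of k] by simp
  \<comment> \<open>Outside the segment both summands have the same strict sign. Confinement to a
    compact set bounds \<open>E x (z k)\<close>, which forces \<open>E u (z k)\<close> to 0.\<close>
  have zK: "z k \<in> ?K" for k
  proof (rule ccontr)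
    assume "z k \<notin> ?K"
    then have "z k < x \<and> z k < u \<or> z k > x \<and> z k > u"
      by (auto simp: closed_segment_eq_real_ivl split: if_splits)
    then show False
    proof
      assume "z k < x \<and> z k < u"
      then have "E x (z k) > 0" "E u (z k) > 0" using semideviation_pos[OF E(1)] x u z(1) by auto
      then have "E x (z k) / real (Suc k) > 0" by simp
      then show False using \<open>E u (z k) > 0\<close> Ez[of k] by linarith
    next
      assume "z k > x \<and> z k > u"
      then have "E x (z k) < 0" "E u (z k) < 0" using semideviation_neg[OF E(1)] x u z(1) by auto
      then have "E x (z k) / real (Suc k) < 0" by (simp add: divide_neg_pos)
      then show False using \<open>E u (z k) < 0\<close> Ez[of k] by linarith
    qed
  qed
  have cont: "continuous_on ?K (E w)" if "w \<in> I" for w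
    using E(3)[OF that] KI by (rule continuous_on_subset)
  have "bounded (E x ` ?K)"
    using cont[OF x] by (intro compact_imp_bounded compact_continuous_image) auto
  then obtain B where B: "\<And>y. y \<in> ?K \<Longrightarrow> \<bar>E x y\<bar> \<le> B" by (auto simp: bounded_iff)
  have "(\<lambda>k. B * inverse (real (Suc k))) \<longlonglongrightarrow> 0"
    using tendsto_mult[OF tendsto_const LIMSEQ_inverse_real_of_nat, of B] by simp
  moreover have "norm (E u (z k)) \<le> B * inverse (real (Suc k))" for k
    using B[OF zK[of k]] by (simp add: Ez divide_inverse abs_mult mult_right_mono)
  ultimately have "(\<lambda>k. E u (z k)) \<longlonglongrightarrow> 0"
    by (intro Lim_null_comparison[of "\<lambda>k. E u (z k)"]) auto
  then have zu: "z \<longlonglongrightarrow> u"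
  proof (rule tendsto_zero_of_compact[where K = ?K and f = "E u", OF _ cont[OF u] _ zK, rotated 2])
    show "compact ?K" by simp
    show "y = u" if "y \<in> ?K" "E u y = 0" for y
      using that semideviation_eq_0_iff[OF E(1) E(2)[OF u] u, of y] KI by auto
  qed
  \<comment> \<open>The filter \<open>at u within I\<close> excludes \<open>u\<close> itself, so
    \<open>z\<close> must avoid it.\<close>
  have znu: "z k \<noteq> u" for k
  proof
    assume "z k = u"
    then have "E x u = 0" using z(2)[of k] E(2)[OF u] by simp
    then show False using semideviation_eq_0_iff[OF E(1) E(2)[OF x] x u] False by simp
  qed
  have "(E u has_real_derivative ?d) (at u within I)"
    using N u by (simp add: normalizable_def diag_deriv2_def vector_derivative_works
        has_real_derivative_iff_has_vector_derivative)
  then have "((\<lambda>y. E u y / (y - u)) \<longlongrightarrow> ?d) (at u within I)"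
    using E(2)[OF u] by (simp add: has_field_derivative_iff)
  moreover have "filterlim z (at u within I) sequentially"
    using zu z(1) znu by (auto simp: filterlim_at)
  ultimately have q: "(\<lambda>k. E u (z k) / (z k - u)) \<longlonglongrightarrow> ?d"
    by (rule filterlim_compose)
  have "(\<lambda>k. E x (z k)) \<longlonglongrightarrow> E x u"
    using z(1) by (intro continuous_on_tendsto_compose[OF E(3)[OF x] zu u] always_eventually) auto
  then have "(\<lambda>k. - E x (z k) / (E u (z k) / (z k - u))) \<longlonglongrightarrow> - E x u / ?d"
    using q E(4)[OF u] by (intro tendsto_intros) auto
  moreover have "- E x (z k) / (E u (z k) / (z k - u)) = real (Suc k) * (z k - u)" for k
  proof -
    have "- E x (z k) = real (Suc k) * E u (z k)" using Ez[of k] by (simp del: of_nat_Suc)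
    moreover have "E u (z k) \<noteq> 0" using semideviation_eq_0_iff[OF E(1) E(2)[OF u] u z(1)] znu by simp
    ultimately show ?thesis by (simp del: of_nat_Suc)
  qed
  ultimately show ?thesis by (simp add: normalization_def)
qed

text \<open>The hypothesis is applied to the pairs \<open>(x, u)\<close> and \<open>(y, v)\<close>
  with weights \<open>1 / real (Suc k)\<close> and 1. Subtracting the midpoint of \<open>u\<close>
  and \<open>v\<close> and multiplying by \<open>real (Suc k)\<close> gives an inequality whose
  limit is the claim.\<close>

lemma jensen_concave_normalization:
  assumes I: "is_interval I" and N: "normalizable I E"
    and ii: "\<And>n x y l. x \<in> tuples I n \<Longrightarrow> y \<in> tuples I n \<Longrightarrow> l \<in> weights n \<Longrightarrow>
         D_upper_upper I E n (\<lambda>i. (x i + y i) / 2) l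
           \<ge> (D_lower_lower I E n x l + D_lower_lower I E n y l) / 2"
  shows "jensen_concave2 I (normalization I E)"
  unfolding jensen_concave2_def
proof (intro ballI)
  fix x y u v assume I': "x \<in> I" "y \<in> I" "u \<in> I" "v \<in> I"
  define X Y l where "X = (\<lambda>i::nat. if i = 0 then x else u)"
    and "Y = (\<lambda>i::nat. if i = 0 then y else v)"
    and "l = (\<lambda>(k::nat) i::nat. if i = 0 then 1 / real (Suc k) else 1)"
  define m where "m = (\<lambda>i. (X i + Y i) / 2)"
  have esum2: "esum E 2 w (l k) t = E (w 0) t / real (Suc k) + E (w 1) t" for w k t
    by (simp add: esum_def l_def numeral_2_eq_2)
  have T: "X \<in> tuples I 2" "Y \<in> tuples I 2" using I' by (auto simp: X_def Y_def tuples_def)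
  have Tm: "m \<in> tuples I 2" unfolding m_def using tuples_mid[OF I T] .
  have L: "l k \<in> weights 2" for k
    by (auto simp: l_def weights_def numeral_2_eq_2 intro!: add_nonneg_pos)
  \<comment> \<open>The limit is the same for all four means, so it does not matter that the two
    sides of the hypothesis use different ones.\<close>
  have as: "(\<lambda>k. real (Suc k) * (M 2 w (l k) - w 1)) \<longlonglongrightarrow> normalization I E (w 0) (w 1)"
    if "M \<in> {D_lower_lower I E, D_lower I E, D_upper I E, D_upper_upper I E}" "w \<in> tuples I 2" for M w
    by (rule zeros_asymptotics[OF I N])
      (use that mean_zero[OF I N that(2) L that(1)] in \<open>auto simp: tuples_def esum2 simp del: of_nat_Suc\<close>)
  have "(normalization I E (X 0) (X 1) + normalization I E (Y 0) (Y 1)) / 2 \<le> normalization I E (m 0) (m 1)"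
  proof (rule LIMSEQ_le)
    show "(\<lambda>k. (real (Suc k) * (D_lower_lower I E 2 X (l k) - X 1) +
        real (Suc k) * (D_lower_lower I E 2 Y (l k) - Y 1)) / 2) \<longlonglongrightarrow>
        (normalization I E (X 0) (X 1) + normalization I E (Y 0) (Y 1)) / 2"
      by (intro tendsto_intros as T) auto
    show "(\<lambda>k. real (Suc k) * (D_upper_upper I E 2 m (l k) - m 1)) \<longlonglongrightarrow> normalization I E (m 0) (m 1)"
      by (intro as Tm) auto
    have "(real (Suc k) * (D_lower_lower I E 2 X (l k) - X 1) +
        real (Suc k) * (D_lower_lower I E 2 Y (l k) - Y 1)) / 2
        \<le> real (Suc k) * (D_upper_upper I E 2 m (l k) - m 1)" for k
    proof -
      have "(real (Suc k) * (D_lower_lower I E 2 X (l k) - X 1) +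
        real (Suc k) * (D_lower_lower I E 2 Y (l k) - Y 1)) / 2
        = real (Suc k) * ((D_lower_lower I E 2 X (l k) + D_lower_lower I E 2 Y (l k)) / 2 - m 1)"
        by (simp add: m_def field_simps)
      also have "\<dots> \<le> real (Suc k) * (D_upper_upper I E 2 m (l k) - m 1)"
        using ii[OF T L] by (intro mult_left_mono) (auto simp: m_def)
      finally show ?thesis .
    qed
    then show "\<exists>N. \<forall>k\<ge>N. (real (Suc k) * (D_lower_lower I E 2 X (l k) - X 1) +
        real (Suc k) * (D_lower_lower I E 2 Y (l k) - Y 1)) / 2
        \<le> real (Suc k) * (D_upper_upper I E 2 m (l k) - m 1)" by blast
  qed
  then show "normalization I E ((x + y) / 2) ((u + v) / 2)
      \<ge> (normalization I E x u + normalization I E y v) / 2"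
    by (simp add: X_def Y_def m_def)
qed

section \<open>From concavity of the normalization to the quasideviation property\<close>

text \<open>A minimum point chosen as far left as possible cannot be interior, as it would have a
  strictly larger value on its left.\<close>

lemma midpoint_concave_neg:
  fixes h :: "real \<Rightarrow> real"
  assumes h: "continuous_on {x..s} h"
    and mid: "\<And>u v. u \<in> {x..s} \<Longrightarrow> v \<in> {x..s} \<Longrightarrow> h ((u + v) / 2) \<ge> (h u + h v) / 2"
    and t: "x < t" "t < s" "h x > 0" "h t = 0"
  shows "h s < 0"
proof (rule ccontr)
  assume "\<not> h s < 0"
  obtain q where q: "q \<in> {x..s}" "\<And>y. y \<in> {x..s} \<Longrightarrow> h q \<le> h y"
    using continuous_attains_inf[OF _ _ h] t by fastforce
  let ?S = "{x..s} \<inter> h -` {h q}"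
  have "compact ?S"
    using continuous_closed_preimage[OF h, of "{h q}"] by (metis bounded_Int bounded_closed_interval closed_atLeastAtMost closed_singleton compact_eq_bounded_closed)
  then obtain p where p: "p \<in> ?S" "\<And>y. y \<in> ?S \<Longrightarrow> p \<le> y"
    using compact_attains_inf[of ?S] q by blast
  have "h q \<le> 0" using q(2)[of t] t by auto
  have "h p = h q" using p(1) by simp
  then have "x \<noteq> p" using t(3) \<open>h q \<le> 0\<close> by auto
  \<comment> \<open>At \<open>s\<close> the minimum would be both nonnegative and at most
    \<open>h t = 0\<close>, so \<open>t\<close> would be a minimum point further left.\<close>
  moreover have "p \<noteq> s"
  proof
    assume "p = s"
    then have "h t = h q" using \<open>h p = h q\<close> \<open>\<not> h s < 0\<close> \<open>h q \<le> 0\<close> t by auto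
    then show False using p(2)[of t] t \<open>p = s\<close> by auto
  qed
  ultimately have ps: "x < p" "p < s" using p by auto
  define d where "d = min (p - x) (s - p)"
  have d: "d > 0" "p - d \<in> {x..s}" "p + d \<in> {x..s}" using ps by (auto simp: d_def)
  have "h (p - d) \<noteq> h q" using p(2)[of "p - d"] d by auto
  then have "h (p - d) > h q" "h (p + d) \<ge> h q" using q(2) d by (auto simp: less_le)
  moreover have "h p \<ge> (h (p - d) + h (p + d)) / 2" using mid[OF d(2,3)] by simp
  ultimately show False using \<open>h p = h q\<close> by simp
qed

lemma quasideviation_normalization:
  assumes I: "is_interval I" and N: "normalizable I E"
    and J: "jensen_concave2 I (normalization I E)"
  shows "quasideviation I (normalization I E)"
proof -
  note E = normalizableD[OF N]
  let ?F = "normalization I E"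
  have semi: "semideviation I ?F"
    using E by (auto simp: semideviation_def normalization_def sgn_divide)
  have cont: "continuous_on I (?F x)" if "x \<in> I" for x
    unfolding normalization_def
    using E that by (intro continuous_intros) force+
  have "?F y t / ?F x t < ?F y s / ?F x s"
    if xy: "x \<in> I" "y \<in> I" and ts: "x < t" "t < s" "s < y" for x y t s
  proof -
    have sub: "{x..y} \<subseteq> I" using I xy by (meson atLeastAtMost_iff mem_is_interval_1_I subsetI)
    then have I': "t \<in> I" "s \<in> I" using ts by auto
    \<comment> \<open>These coefficients make \<open>h\<close> vanish at \<open>t\<close>. Dividing
      \<open>h s < 0\<close> by the positive product \<open>?F x t * ?F x s\<close> then gives the
      inequality between the ratios.\<close>
    define \<alpha> \<beta> where "\<alpha> = ?F y t" and "\<beta> = - ?F x t"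
    have ab: "\<alpha> > 0" "\<beta> > 0"
      using semideviation_pos[OF semi] semideviation_neg[OF semi] xy I' ts by (auto simp: \<alpha>_def \<beta>_def)
    define h where "h = (\<lambda>r. \<alpha> * ?F x r + \<beta> * ?F y r)"
    have "h s < 0"
    proof (rule midpoint_concave_neg[of x s h t])
      show "continuous_on {x..s} h" unfolding h_def
        by (intro continuous_intros continuous_on_subset[OF cont] xy) (use sub ts in auto)
      have "?F x x = 0" using E xy by (simp add: normalization_def)
      then show "h x > 0" using semideviation_pos[OF semi, of y x] xy ts ab by (simp add: h_def)
      show "h t = 0" by (simp add: h_def \<alpha>_def \<beta>_def)
      show "h ((u + v) / 2) \<ge> (h u + h v) / 2" if "u \<in> {x..s}" "v \<in> {x..s}" for u v
      proof -
        have uv: "u \<in> I" "v \<in> I" using that sub ts by auto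
        \<comment> \<open>Joint concavity with \<open>w\<close> as both first arguments, since
          \<open>w\<close> is its own midpoint.\<close>
        have "?F w ((u + v) / 2) \<ge> (?F w u + ?F w v) / 2" if "w \<in> I" for w
          using J uv that unfolding jensen_concave2_def by (metis field_sum_of_halves add_divide_distrib)
        from mult_left_mono[OF this[OF xy(1)], of \<alpha>] mult_left_mono[OF this[OF xy(2)], of \<beta>]
        show ?thesis using ab by (simp add: h_def field_simps)
      qed
    qed (use ts in auto)
    moreover have "?F x t < 0" "?F x s < 0" using semideviation_neg[OF semi] xy I' ts by auto
    ultimately show ?thesis
      by (simp add: h_def \<alpha>_def \<beta>_def field_simps)
  qed
  then show ?thesis
    using semi cont by (auto simp: quasideviation_def strict_mono_on_def)
qed

text \<open>The normalizing factor depends only on the second argument and cancels in the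
  ratios.\<close>

lemma quasideviation_of_normalization:
  assumes I: "is_interval I" and N: "normalizable I E"
    and Q: "quasideviation I (normalization I E)"
  shows "quasideviation I E"
proof -
  note E = normalizableD[OF N]
  have "strict_mono_on {x<..<y} (\<lambda>t. E y t / E x t)" if "x \<in> I" "y \<in> I" "x < y" for x y
  proof -
    have "E y t / E x t = normalization I E y t / normalization I E x t" if "t \<in> {x<..<y}" for t
    proof -
      have "t \<in> I"
        by (rule mem_is_interval_1_I[OF I \<open>x \<in> I\<close> \<open>y \<in> I\<close>]) (use that in auto)
      then show ?thesis using E(4)[of t] by (simp add: normalization_def)
    qed
    then show ?thesis
      using Q that by (auto simp: quasideviation_def strict_mono_on_def)
  qed
  then show ?thesis using E by (auto simp: quasideviation_def)
qed

section \<open>Uniqueness of the zero of the sum for a quasideviation\<close>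

text \<open>At a zero \<open>t\<close> of \<open>e\<close>, the smallest ratio \<open>c = E(x\<^sub>i, s) / E(x\<^sub>i, t)\<close> over \<open>x\<^sub>i < t\<close> satisfies
  \<open>E(x\<^sub>j, s) \<le> c E(x\<^sub>j, t)\<close> for all \<open>j\<close>, strictly if \<open>x\<^sub>j > t\<close>.\<close>

lemma esum_neg_after_zero:
  assumes Q: "quasideviation I E" and E0: "\<And>x. x \<in> I \<Longrightarrow> E x x = 0"
    and x: "x \<in> tuples I n" and l: "l \<in> weights n"
    and t: "t \<in> I" "esum E n x l t = 0" and s: "s \<in> I" "t < s"
  shows "esum E n x l s < 0"
proof -
  have semi: "semideviation I E" using Q by (simp add: quasideviation_def)
  note pos = semideviation_pos[OF semi] and neg = semideviation_neg[OF semi]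
  have xI: "x i \<in> I" if "i < n" for i using x that by (auto simp: tuples_def)
  define L where "L = {i. i < n \<and> l i > 0 \<and> x i < t}"
  show ?thesis
  proof (cases "L = {}")
    \<comment> \<open>All weighted terms at \<open>t\<close> are nonnegative with sum 0, so every
      \<open>x i\<close> of positive weight equals \<open>t\<close>, and
      \<open>E t s < 0\<close>.\<close>
    case True
    have "- E (x i) s > 0" if "i < n" "l i > 0" for i
    proof -
      have *: "E (x j) t \<ge> 0" if "j < n" "l j > 0" for j
        using that True pos[OF xI[OF that(1)] t(1)] E0[OF t(1)]
        by (cases "x j = t") (auto simp: L_def)
      have "(\<Sum>j<n. l j * E (x j) t) = 0" using t by (simp add: esum_def)
      moreover have "l j * E (x j) t \<ge> 0" if "j \<in> {..<n}" for j
        using * l that by (cases "l j = 0") (force simp: weights_def)+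
      ultimately have "l i * E (x i) t = 0"
        using that(1) by (subst (asm) sum_nonneg_eq_0_iff) auto
      then have "x i = t" using semideviation_eq_0_iff[OF semi E0] that xI t by auto
      then show ?thesis using neg[OF t(1) s] by simp
    qed
    then show ?thesis using esum_pos[OF l, of "\<lambda>x y. - E x y" x s] by (simp add: esum_uminus)
  next
    case False
    define r where "r = (\<lambda>i. E (x i) s / E (x i) t)"
    define c where "c = Min (r ` L)"
    have fin: "finite L" by (simp add: L_def)
    have "c \<in> r ` L" using fin False by (simp add: c_def)
    then obtain i0 where i0: "i0 < n" "l i0 > 0" "x i0 < t" "c = r i0" by (auto simp: L_def)
    have "c > 0" using i0 neg xI t s by (simp add: r_def divide_neg_neg)
    have *: "E (x j) s \<le> c * E (x j) t" if j: "j < n" "l j > 0" "x j < t" for j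
    proof -
      have "c \<le> r j" using fin j by (auto simp: c_def L_def)
      moreover have "E (x j) t < 0" using j neg xI t by auto
      ultimately show ?thesis by (simp add: r_def field_simps)
    qed
    have **: "E (x j) s < c * E (x j) t" if j: "j < n" "x j \<ge> t" for j
    proof (cases "x j > s")
      \<comment> \<open>Now \<open>x i0 < t < s < x j\<close>, so the ratio of
        \<open>E (x j)\<close> to \<open>E (x i0)\<close> increases from \<open>t\<close> to
        \<open>s\<close>; multiplying by the negative \<open>E (x i0) s\<close> gives the
        bound.\<close>
      case True
      have "strict_mono_on {x i0<..<x j} (\<lambda>t. E (x j) t / E (x i0) t)"
        using Q i0 j True s xI by (auto simp: quasideviation_def)
      then have "E (x j) t / E (x i0) t < E (x j) s / E (x i0) s"
        using i0 True s by (auto simp: strict_mono_on_def)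
      moreover have "E (x i0) t < 0" "E (x i0) s < 0" using neg i0 xI t s by auto
      ultimately show ?thesis by (simp add: i0(4) r_def field_simps)
    next
      \<comment> \<open>For \<open>t \<le> x j \<le> s\<close> the two sides are separated by 0, and
        one inequality is strict because \<open>x j\<close> cannot equal both \<open>t\<close> and
        \<open>s\<close>.\<close>
      case False
      have a: "E (x j) s \<le> 0" using False neg[OF xI[OF j(1)] s(1)] E0[OF s(1)] by (cases "x j = s") auto
      have b: "E (x j) t \<ge> 0" using j pos[OF xI[OF j(1)] t(1)] E0[OF t(1)] by (cases "x j = t") auto
      show ?thesis
      proof (cases "x j = s")
        case True
        then have "E (x j) t > 0" using pos t s by simp
        then show ?thesis using a \<open>c > 0\<close> by (smt (verit) mult_pos_pos)
      next
        case neq: False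
        then have "E (x j) s < 0" using neg xI j s False by auto
        then show ?thesis using b \<open>c > 0\<close> by (smt (verit) mult_nonneg_nonneg)
      qed
    qed
    \<comment> \<open>This index makes the summed inequality strict; without it the sum at
      \<open>t\<close> would be negative.\<close>
    have "\<exists>j<n. l j > 0 \<and> x j \<ge> t"
    proof (rule ccontr)
      assume "\<not> ?thesis"
      then have "esum (\<lambda>x y. - E x y) n x l t > 0"
        using neg xI t by (intro esum_pos[OF l]) force
      then show False using t by (simp add: esum_uminus)
    qed
    then obtain j0 where j0: "j0 < n" "l j0 > 0" "x j0 \<ge> t" by auto
    have "(\<Sum>j<n. l j * E (x j) s) < (\<Sum>j<n. l j * (c * E (x j) t))"
    proof (rule sum_strict_mono_ex1)
      show "\<forall>j\<in>{..<n}. l j * E (x j) s \<le> l j * (c * E (x j) t)"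
      proof
        fix j assume j: "j \<in> {..<n}"
        then have "l j \<ge> 0" using l by (auto simp: weights_def)
        show "l j * E (x j) s \<le> l j * (c * E (x j) t)"
        proof (cases "l j = 0")
          case False
          then have "E (x j) s \<le> c * E (x j) t"
            using *[of j] **[of j] j \<open>l j \<ge> 0\<close> by force
          then show ?thesis using \<open>l j \<ge> 0\<close> by (rule mult_left_mono)
        qed simp
      qed
      show "\<exists>j\<in>{..<n}. l j * E (x j) s < l j * (c * E (x j) t)"
        using j0 ** by (auto intro!: bexI[of _ j0])
    qed simp
    also have "\<dots> = c * esum E n x l t" by (simp add: esum_def sum_distrib_left algebra_simps)
    finally show ?thesis using t by (simp add: esum_def)
  qed
qed

text \<open>Each mean is a zero of the sum, and of two distinct zeros the larger would contradict
  \<open>esum_neg_after_zero\<close>.\<close>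

lemma mean_eq_D_quasi:
  assumes I: "is_interval I" and N: "normalizable I E" and Q: "quasideviation I E"
    and x: "x \<in> tuples I n" and l: "l \<in> weights n"
    and M: "M \<in> {D_lower_lower I E, D_lower I E, D_upper I E, D_upper_upper I E}"
  shows "M n x l = D_quasi I E n x l"
proof -
  note z = mean_zero[OF I N x l M]
  note neg = esum_neg_after_zero[OF Q normalizableD(2)[OF N] x l]
  have "D_quasi I E n x l = M n x l" unfolding D_quasi_def
  proof (rule the_equality)
    fix y assume y: "y \<in> I \<and> esum E n x l y = 0"
    show "y = M n x l"
      using neg[of y "M n x l"] neg[of "M n x l" y] y z by (cases y "M n x l" rule: linorder_cases) auto
  qed (use z in auto)
  then show ?thesis by simp
qed

section \<open>From concavity of the normalization to concavity of the mean\<close>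

text \<open>For normalizable \<open>E\<close> the denominator is positive on \<open>I\<close>, so
  normalization preserves the zeros and signs of the sum.\<close>

lemma esum_normalization:
  "esum (normalization I E) n x l y = esum E n x l y / (- diag_deriv2 I E y)"
  by (simp add: esum_def normalization_def sum_divide_distrib sum_negf)

lemma jensen_concave_D_quasi:
  assumes I: "is_interval I" and N: "normalizable I E"
    and J: "jensen_concave2 I (normalization I E)"
  shows "jensen_concave_mean I (D_quasi I E)"
  unfolding jensen_concave_mean_def
proof (intro allI ballI)
  fix n x y l assume x: "x \<in> tuples I n" and y: "y \<in> tuples I n" and l: "l \<in> weights n"
  let ?F = "normalization I E" and ?D = "D_upper_upper I E" and ?m = "\<lambda>i. (x i + y i) / 2"
  have Q: "quasideviation I E"
    using quasideviation_of_normalization[OF I N quasideviation_normalization[OF I N J]] .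
  have m: "?m \<in> tuples I n" using tuples_mid[OF I x y] .
  \<comment> \<open>\<open>D_upper_upper\<close> represents the common value because it dominates
    every point where the sum is nonnegative; the midpoint of the zeros \<open>z\<close> and
    \<open>w\<close> will be such a point.\<close>
  have eq: "D_quasi I E n w l = ?D n w l" if "w \<in> tuples I n" for w
    using mean_eq_D_quasi[OF I N Q that l, of ?D] by simp
  define z w where "z = ?D n x l" and "w = ?D n y l"
  have z: "z \<in> I" "esum E n x l z = 0" and w: "w \<in> I" "esum E n y l w = 0"
    using mean_zero[OF I N x l, of ?D] mean_zero[OF I N y l, of ?D] by (auto simp: z_def w_def)
  have zw: "(z + w) / 2 \<in> I"
    using tuples_mid[OF I, of "\<lambda>_. z" 1 "\<lambda>_. w"] z w by (auto simp: tuples_def)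
  have "(esum ?F n x l z + esum ?F n y l w) / 2 = (\<Sum>i<n. l i * ((?F (x i) z + ?F (y i) w) / 2))"
    by (simp add: esum_def sum.distrib[symmetric] sum_divide_distrib algebra_simps)
  also have "\<dots> \<le> esum ?F n ?m l ((z + w) / 2)"
    unfolding esum_def
    using J x y z w l by (intro sum_mono mult_left_mono) (auto simp: jensen_concave2_def tuples_def weights_def)
  finally have "esum E n ?m l ((z + w) / 2) \<ge> 0"
    using z w normalizableD(4)[OF N zw] by (simp add: esum_normalization zero_le_divide_iff divide_le_0_iff)
  then have "(z + w) / 2 \<le> ?D n ?m l" by (rule D_upper_upper_ge[OF N m l zw])
  then show "D_quasi I E n ?m l \<ge> (D_quasi I E n x l + D_quasi I E n y l) / 2"
    using eq x y m by (simp add: z_def w_def)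
qed

section \<open>The cycle of implications\<close>

theorem theorem5p4:
  fixes I :: "real set" and E :: "real \<Rightarrow> real \<Rightarrow> real"
  assumes "is_interval I" and "normalizable I E"
  shows
    "((\<exists>M\<in>{D_lower_lower I E, D_lower I E, D_upper I E, D_upper_upper I E}.
         jensen_concave_mean I M)
      \<longleftrightarrow>
      (\<forall>n. \<forall>x\<in>tuples I n. \<forall>y\<in>tuples I n. \<forall>l\<in>weights n.
         D_upper_upper I E n (\<lambda>i. (x i + y i) / 2) l
           \<ge> (D_lower_lower I E n x l + D_lower_lower I E n y l) / 2))
     \<and>
     ((\<forall>n. \<forall>x\<in>tuples I n. \<forall>y\<in>tuples I n. \<forall>l\<in>weights n.
         D_upper_upper I E n (\<lambda>i. (x i + y i) / 2) l
           \<ge> (D_lower_lower I E n x l + D_lower_lower I E n y l) / 2)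
      \<longleftrightarrow>
      jensen_concave2 I (normalization I E))
     \<and>
     (jensen_concave2 I (normalization I E)
      \<longleftrightarrow>
      quasideviation I (normalization I E) \<and> jensen_concave_mean I (D_quasi I E))
     \<and>
     (quasideviation I (normalization I E) \<and> jensen_concave_mean I (D_quasi I E)
      \<longleftrightarrow>
      (\<forall>M\<in>{D_lower_lower I E, D_lower I E, D_upper I E, D_upper_upper I E}.
         jensen_concave_mean I M))
     \<and>
     (quasideviation I (normalization I E) \<longrightarrow> quasideviation I E)"
  (is "(?i \<longleftrightarrow> ?ii) \<and> (?ii \<longleftrightarrow> ?iii) \<and> (?iii \<longleftrightarrow> ?iv) \<and> (?iv \<longleftrightarrow> ?v) \<and> (?Q \<longrightarrow> ?Q')")
proof -
  note I = assms(1) and N = assms(2)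
  let ?\<M> = "{D_lower_lower I E, D_lower I E, D_upper I E, D_upper_upper I E}"
  have Q: "?Q \<Longrightarrow> ?Q'" using quasideviation_of_normalization[OF I N] .
  \<comment> \<open>Any of the means lies between the least and the greatest zero, so concavity of
    one yields the weaker inequality between these extremes.\<close>
  have "?i \<Longrightarrow> ?ii"
  proof (intro allI ballI)
    fix n x y l
    assume x: "x \<in> tuples I n" and y: "y \<in> tuples I n" and l: "l \<in> weights n" and ?i
    define m where "m = (\<lambda>i. (x i + y i) / 2)"
    obtain M where M: "M \<in> ?\<M>" "jensen_concave_mean I M" using \<open>?i\<close> by blast
    note z = mean_zero[OF I N _ l M(1)]
    have m: "m \<in> tuples I n" unfolding m_def using tuples_mid[OF I x y] .
    have "D_lower_lower I E n x l \<le> M n x l" "D_lower_lower I E n y l \<le> M n y l"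
      using z x y by (auto intro!: D_lower_lower_le[OF N _ l])
    moreover have "M n m l \<le> D_upper_upper I E n m l"
      using z m by (auto intro!: D_upper_upper_ge[OF N _ l])
    moreover have "(M n x l + M n y l) / 2 \<le> M n m l"
      using M(2) x y l by (auto simp: jensen_concave_mean_def m_def)
    ultimately show "D_upper_upper I E n (\<lambda>i. (x i + y i) / 2) l
        \<ge> (D_lower_lower I E n x l + D_lower_lower I E n y l) / 2"
      unfolding m_def[symmetric] by argo
  qed
  moreover have "?ii \<Longrightarrow> ?iii" using jensen_concave_normalization[OF I N] by blast
  moreover have "?iii \<Longrightarrow> ?iv"
    using quasideviation_normalization[OF I N] jensen_concave_D_quasi[OF I N] by blast
  moreover have "?iv \<Longrightarrow> ?v"
  proof
    fix M assume iv: ?iv and M: "M \<in> ?\<M>"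
    have "M n x l = D_quasi I E n x l" if "x \<in> tuples I n" "l \<in> weights n" for n x l
      using mean_eq_D_quasi[OF I N Q that M] iv by blast
    then show "jensen_concave_mean I M"
      using iv tuples_mid[OF I] by (simp add: jensen_concave_mean_def)
  qed
  moreover have "?v \<Longrightarrow> ?i" by blast
  ultimately show ?thesis using Q by argo
qed

end
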